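(* Let $n\geqslant 5$ and let $$p(x)=a_nx^n+a_{n-1}x^{n-1}+a_{n-2}x^{n-2}+\dots+a_2x^2+a_1x+a_0$$ with $a_i\in\mathbb{C}$ for all $i\in\{0,1,\dots,n\}$ and $a_n\neq 0$. The scalar polynomial ODE $\dot{x}=p(x)$ can be quadratized using exactly one new variable if and only if there exist $a,b\in\mathbb{C}$ such that $$p\left(x-\frac{a_{n-1}}{n\cdot a_n}\right)=a_nx^n+ax^2+bx$$ as polynomials in $x$. Moreover, in this case the new variable can be taken to be $$z:=\left(x+\frac{a_{n-1}}{n\cdot a_n}\right)^{n-1}.$$
   Context: Let $p(x)\in\mathbb{C}[x]$ and consider the scalar polynomial ODE $\dot{x}=p(x)$. A list of $m$ new variables $z_1:=z_1(x),\dots,z_m:=z_m(x)$, where each $z_i(x)\in\mathbb{C}[x]$, is said to quadratize $\dot{x}=p(x)$ if there exist polynomials $h_1,\dots,h_{m+1}$ in $m+1$ variables over $\mathbb{C}$, each of total degree at most two, such that the following identities hold in $\mathbb{C}[x]$: $p(x)=h_1(x,z_1(x),\dots,z_m(x))$ and, for $1\leqslant i\leqslant m$, $\dot z_i:=z_i'(x)\,p(x)=h_{i+1}(x,z_1(x),\dots,z_m(x))$. The ODE can be quadratized using exactly $m$ new variables if some list of $m$ new variables quadratizes it. *)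

theory Defs
  imports "HOL-Computational_Algebra.Computational_Algebra" "HOL-Library.Poly_Mapping"
begin

text \<open>Multivariate polynomials over the complex numbers in the variables \<open>0, 1, 2, \<dots>\<close>:
  a finitely supported map from monomials (finitely supported exponent functions) to coefficients.\<close>

type_synonym cmpoly = "(nat \<Rightarrow>\<^sub>0 nat) \<Rightarrow>\<^sub>0 complex"

definition in_variables :: "nat \<Rightarrow> cmpoly \<Rightarrow> bool" where
  "in_variables k h \<longleftrightarrow> (\<forall>mon \<in> Poly_Mapping.keys h. Poly_Mapping.keys mon \<subseteq> {..<k})"

definition monomial_degree :: "(nat \<Rightarrow>\<^sub>0 nat) \<Rightarrow> nat" where
  "monomial_degree mon = (\<Sum>v \<in> Poly_Mapping.keys mon. Poly_Mapping.lookup mon v)"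

definition total_degree_le :: "nat \<Rightarrow> cmpoly \<Rightarrow> bool" where
  "total_degree_le d h \<longleftrightarrow> (\<forall>mon \<in> Poly_Mapping.keys h. monomial_degree mon \<le> d)"

definition subst_polys :: "cmpoly \<Rightarrow> complex poly list \<Rightarrow> complex poly" where
  "subst_polys h ws = (\<Sum>mon \<in> Poly_Mapping.keys h.
     smult (Poly_Mapping.lookup h mon)
       (\<Prod>v \<in> Poly_Mapping.keys mon. (ws ! v) ^ Poly_Mapping.lookup mon v))"

text \<open>Variable \<open>0\<close> stands for \<open>x\<close> (the polynomial \<open>[:0, 1:]\<close>) and variable \<open>i + 1\<close> for the new
  variable \<open>zs ! i\<close>. Indices are shifted by one: \<open>h 0\<close> expresses \<open>p\<close> and \<open>h (Suc i)\<close> expresses the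
  time derivative of \<open>zs ! i\<close> along the ODE.\<close>

definition quadratizes :: "complex poly list \<Rightarrow> complex poly \<Rightarrow> bool" where
  "quadratizes zs p \<longleftrightarrow>
     (\<exists>h :: nat \<Rightarrow> cmpoly.
        (\<forall>i \<le> length zs. in_variables (length zs + 1) (h i) \<and> total_degree_le 2 (h i)) \<and>
        p = subst_polys (h 0) ([:0, 1:] # zs) \<and>
        (\<forall>i < length zs. pderiv (zs ! i) * p = subst_polys (h (Suc i)) ([:0, 1:] # zs)))"

definition quadratizable_with :: "nat \<Rightarrow> complex poly \<Rightarrow> bool" where
  "quadratizable_with m p \<longleftrightarrow> (\<exists>zs. length zs = m \<and> quadratizes zs p)"

end

theory Submission
  imports Defs
begin

text \<open>A quadratic identity in \<open>x\<close> and \<open>z\<close> reads \<open>q = A z\<^sup>2 + L z + G\<close> with \<open>A\<close> constant,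
  \<open>deg L \<le> 1\<close> and \<open>deg G \<le> 2\<close>. Comparing degrees in the identities for \<open>p\<close> and \<open>z' p\<close> forces
  \<open>deg z = n - 1\<close> and \<open>p = L z + G\<close> with \<open>deg L = 1\<close>. Dividing \<open>G\<close> by \<open>L\<close> and absorbing the
  quotient into \<open>z\<close> makes \<open>G\<close> a constant \<open>g\<close>, and the identity for \<open>z' p\<close> becomes
  \<open>z (L z' - D z - M) = H - g z'\<close> with \<open>deg H \<le> 2\<close>. The right-hand side has degree less than \<open>z\<close>,
  so both sides vanish; hence \<open>g = 0\<close>, \<open>p = L z\<close> and \<open>L z' = D z + M\<close> with \<open>deg M \<le> 1\<close>. In the
  coordinate centred at the root of \<open>L\<close>, this equation leaves only the coefficients of \<open>z\<close> at
  \<open>0\<close>, \<open>1\<close> and \<open>n - 1\<close>.\<close>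

section \<open>Quadratic expressions in x and z as univariate polynomials\<close>

definition quadratic_in :: "complex poly \<Rightarrow> complex poly \<Rightarrow> bool" where
  "quadratic_in z q \<longleftrightarrow> (\<exists>A L G. degree L \<le> 1 \<and> degree G \<le> 2 \<and> q = smult A (z ^ 2) + L * z + G)"

lemma quadratic_inI:
  "q = smult A (z ^ 2) + L * z + G \<Longrightarrow> degree L \<le> 1 \<Longrightarrow> degree G \<le> 2 \<Longrightarrow> quadratic_in z q"
  unfolding quadratic_in_def by blast

lemma quadratic_inE:
  assumes "quadratic_in z q"
  obtains A L G where "q = smult A (z ^ 2) + L * z + G" "degree L \<le> 1" "degree G \<le> 2"
  using assms unfolding quadratic_in_def by blast

lemma quadratic_in_0: "quadratic_in z 0"
  by (rule quadratic_inI[of _ 0 _ 0 0]) auto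

lemma quadratic_in_add:
  assumes "quadratic_in z q" "quadratic_in z r"
  shows "quadratic_in z (q + r)"
proof -
  obtain A L G where 1: "q = smult A (z ^ 2) + L * z + G" "degree L \<le> 1" "degree G \<le> 2"
    using assms(1) by (rule quadratic_inE)
  obtain B M H where 2: "r = smult B (z ^ 2) + M * z + H" "degree M \<le> 1" "degree H \<le> 2"
    using assms(2) by (rule quadratic_inE)
  show ?thesis
    by (rule quadratic_inI[of _ "A + B" _ "L + M" "G + H"])
      (use 1 2 in \<open>auto simp: algebra_simps smult_add_left intro: degree_add_le\<close>)
qed

lemma quadratic_in_smult:
  assumes "quadratic_in z q"
  shows "quadratic_in z (smult c q)"
proof -
  obtain A L G where 1: "q = smult A (z ^ 2) + L * z + G" "degree L \<le> 1" "degree G \<le> 2"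
    using assms(1) by (rule quadratic_inE)
  show ?thesis
    by (rule quadratic_inI[of _ "c * A" _ "smult c L" "smult c G"])
      (use 1 in \<open>auto simp: algebra_simps smult_add_right intro: order_trans[OF degree_smult_le]\<close>)
qed

lemma quadratic_in_sum:
  assumes "finite S" "\<And>s. s \<in> S \<Longrightarrow> quadratic_in z (f s)"
  shows "quadratic_in z (\<Sum>s\<in>S. f s)"
  using assms by (induction S rule: finite_induct) (auto intro: quadratic_in_0 quadratic_in_add)

lemma quadratic_in_monomial:
  assumes "i + j \<le> 2"
  shows "quadratic_in z ([:0, 1:] ^ i * z ^ j)"
proof -
  have "(i, j) \<in> {(0,0), (1,0), (2,0), (0,1), (1,1), (0,2)}"
    using assms by auto
  moreover have "quadratic_in z 1" "quadratic_in z [:0, 1:]" "quadratic_in z ([:0, 1:] ^ 2)"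
    by (rule quadratic_inI[of _ 0 _ 0], auto simp: power2_eq_square)+
  moreover have "quadratic_in z z" "quadratic_in z ([:0, 1:] * z)" "quadratic_in z (z ^ 2)"
    by (rule quadratic_inI[of _ 0 _ 1 0] quadratic_inI[of _ 0 _ "[:0, 1:]" 0]
        quadratic_inI[of _ 1 _ 0 0], auto)+
  ultimately show ?thesis by auto
qed

section \<open>Evaluating bivariate polynomials of total degree at most two\<close>

lemma monomial_degree_superset:
  assumes "finite V" "Poly_Mapping.keys mon \<subseteq> V"
  shows "monomial_degree mon = (\<Sum>v\<in>V. Poly_Mapping.lookup mon v)"
  unfolding monomial_degree_def
  by (rule sum.mono_neutral_left) (use assms in \<open>auto simp: in_keys_iff\<close>)

lemma monomial_value_superset:
  fixes ws :: "complex poly list"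
  assumes "finite V" "Poly_Mapping.keys mon \<subseteq> V"
  shows "(\<Prod>v\<in>Poly_Mapping.keys mon. (ws ! v) ^ Poly_Mapping.lookup mon v)
    = (\<Prod>v\<in>V. (ws ! v) ^ Poly_Mapping.lookup mon v)"
  by (rule prod.mono_neutral_left) (use assms in \<open>auto simp: in_keys_iff\<close>)

text \<open>Cancellation can make the support of a sum smaller than the union of the supports, so
  additivity is proved over a common index set on which missing monomials count as zero.\<close>

lemma subst_polys_superset:
  assumes "finite S" "Poly_Mapping.keys h \<subseteq> S"
  shows "subst_polys h ws = (\<Sum>mon\<in>S. smult (Poly_Mapping.lookup h mon)
    (\<Prod>v\<in>Poly_Mapping.keys mon. (ws ! v) ^ Poly_Mapping.lookup mon v))"
  unfolding subst_polys_def
  by (rule sum.mono_neutral_left) (use assms in \<open>auto simp: in_keys_iff\<close>)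

lemma subst_polys_add: "subst_polys (h + g) ws = subst_polys h ws + subst_polys g ws"
proof -
  let ?S = "Poly_Mapping.keys h \<union> Poly_Mapping.keys g"
  have "Poly_Mapping.keys (h + g) \<subseteq> ?S" by (rule Poly_Mapping.keys_add)
  then show ?thesis
    by (simp add: subst_polys_superset[of ?S] lookup_add smult_add_left sum.distrib)
qed

lemma lessThan_2: "{..<2::nat} = {0, 1}"
  by auto

lemma quadratic_in_subst_polys:
  assumes "in_variables 2 h" "total_degree_le 2 h"
  shows "quadratic_in z (subst_polys h [[:0, 1:], z])"
  unfolding subst_polys_def
proof (intro quadratic_in_sum quadratic_in_smult)
  fix mon assume mon: "mon \<in> Poly_Mapping.keys h"
  have keys: "Poly_Mapping.keys mon \<subseteq> {0, 1}"
    using assms(1) mon unfolding in_variables_def lessThan_2 by blast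
  have "Poly_Mapping.lookup mon 0 + Poly_Mapping.lookup mon 1 \<le> 2"
    using assms(2) mon monomial_degree_superset[OF _ keys] by (auto simp: total_degree_le_def)
  then show "quadratic_in z (\<Prod>v\<in>Poly_Mapping.keys mon. ([[:0, 1:], z] ! v) ^ Poly_Mapping.lookup mon v)"
    using quadratic_in_monomial by (simp add: monomial_value_superset[OF _ keys])
qed simp

text \<open>This is the condition that \<open>quadratizes\<close> puts on each of its two identities
  when there is a single new variable.\<close>

definition realizable :: "complex poly \<Rightarrow> complex poly \<Rightarrow> bool" where
  "realizable z q \<longleftrightarrow> (\<exists>h. in_variables 2 h \<and> total_degree_le 2 h \<and> q = subst_polys h [[:0, 1:], z])"

lemma realizable_add:
  assumes "realizable z q" "realizable z r"
  shows "realizable z (q + r)"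
proof -
  obtain h g where h: "in_variables 2 h" "total_degree_le 2 h" "q = subst_polys h [[:0, 1:], z]"
    and g: "in_variables 2 g" "total_degree_le 2 g" "r = subst_polys g [[:0, 1:], z]"
    using assms unfolding realizable_def by blast
  have "in_variables 2 (h + g)" "total_degree_le 2 (h + g)"
    using h g Poly_Mapping.keys_add[of h g] unfolding in_variables_def total_degree_le_def by blast+
  then show ?thesis
    unfolding realizable_def using h g by (metis subst_polys_add)
qed

lemma realizable_monomial:
  assumes "i + j \<le> 2"
  shows "realizable z (smult c ([:0, 1:] ^ i * z ^ j))"
proof -
  define mon :: "nat \<Rightarrow>\<^sub>0 nat" where "mon = Poly_Mapping.single 0 i + Poly_Mapping.single 1 j"
  have keys: "Poly_Mapping.keys mon \<subseteq> {0, 1}"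
    unfolding mon_def using Poly_Mapping.keys_add[of "Poly_Mapping.single (0::nat) i" "Poly_Mapping.single 1 j"]
    by (auto split: if_splits)
  have lookup: "Poly_Mapping.lookup mon 0 = i" "Poly_Mapping.lookup mon (Suc 0) = j"
    by (auto simp: mon_def lookup_add lookup_single)
  let ?h = "Poly_Mapping.single mon c"
  have "in_variables 2 ?h"
    using keys unfolding in_variables_def lessThan_2 by simp
  moreover have "total_degree_le 2 ?h"
    using assms monomial_degree_superset[OF _ keys] lookup by (simp add: total_degree_le_def)
  moreover have "subst_polys ?h [[:0, 1:], z] = smult c ([:0, 1:] ^ i * z ^ j)"
    by (subst subst_polys_superset[of "{mon}"])
      (simp_all add: monomial_value_superset[OF _ keys] lookup)
  ultimately show ?thesis
    unfolding realizable_def by metis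
qed

lemma degree_le_1_eq: "degree L \<le> 1 \<Longrightarrow> L = [:coeff L 0, coeff L 1:]"
  by (rule poly_eqI) (auto simp: coeff_pCons coeff_eq_0 split: nat.split)

lemma degree_le_2_eq: "degree G \<le> 2 \<Longrightarrow> G = [:coeff G 0, coeff G 1, coeff G 2:]"
  by (rule poly_eqI) (auto simp: coeff_pCons coeff_eq_0 numeral_2_eq_2 split: nat.split)

text \<open>Only six monomials in x and z have degree at most two; grouping them by the power of z
  gives the form A z^2 + L z + G. From here on only degrees and coefficients in one variable
  matter.\<close>

lemma realizable_iff_quadratic_in: "realizable z q \<longleftrightarrow> quadratic_in z q"
proof
  assume "realizable z q"
  then show "quadratic_in z q"
    unfolding realizable_def using quadratic_in_subst_polys by blast
next
  assume "quadratic_in z q"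
  then obtain A L G where q: "q = smult A (z ^ 2) + L * z + G" and L: "degree L \<le> 1" and G: "degree G \<le> 2"
    by (rule quadratic_inE)
  obtain l0 l1 where L_eq: "L = [:l0, l1:]" using degree_le_1_eq[OF L] by blast
  obtain g0 g1 g2 where G_eq: "G = [:g0, g1, g2:]" using degree_le_2_eq[OF G] by blast
  \<comment> \<open>The powers with exponents 0 and 1 are kept so that every summand matches
    \<open>realizable_monomial\<close>.\<close>
  have "q = smult A ([:0, 1:] ^ 0 * z ^ 2) + smult l1 ([:0, 1:] ^ 1 * z ^ 1) + smult l0 ([:0, 1:] ^ 0 * z ^ 1)
    + smult g2 ([:0, 1:] ^ 2 * z ^ 0) + smult g1 ([:0, 1:] ^ 1 * z ^ 0) + smult g0 ([:0, 1:] ^ 0 * z ^ 0)"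
    unfolding q L_eq G_eq by (simp add: power2_eq_square algebra_simps)
  then show "realizable z q"
    by (simp only:) (intro realizable_add realizable_monomial; simp)
qed

lemma quadratizes_single_iff:
  "quadratizes [z] p \<longleftrightarrow> quadratic_in z p \<and> quadratic_in z (pderiv z * p)"
proof -
  have "quadratizes [z] p \<longleftrightarrow> realizable z p \<and> realizable z (pderiv z * p)"
  proof
    assume "quadratizes [z] p"
    then show "realizable z p \<and> realizable z (pderiv z * p)"
      unfolding quadratizes_def realizable_def
      by (auto simp: le_Suc_eq all_conj_distrib numeral_2_eq_2)
  next
    assume "realizable z p \<and> realizable z (pderiv z * p)"
    then obtain h g where h: "in_variables 2 h" "total_degree_le 2 h" "p = subst_polys h [[:0, 1:], z]"
      and g: "in_variables 2 g" "total_degree_le 2 g" "pderiv z * p = subst_polys g [[:0, 1:], z]"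
      unfolding realizable_def by blast
    then show "quadratizes [z] p"
      unfolding quadratizes_def
      by (intro exI[of _ "\<lambda>i. if i = 0 then h else g"]) (auto simp: numeral_2_eq_2)
  qed
  then show ?thesis by (simp add: realizable_iff_quadratic_in)
qed

lemma quadratizable_with_1_iff: "quadratizable_with 1 p \<longleftrightarrow> (\<exists>z. quadratizes [z] p)"
proof -
  have "length zs = 1 \<longleftrightarrow> (\<exists>z. zs = [z])" for zs :: "complex poly list"
    by (auto simp: length_Suc_conv)
  then show ?thesis unfolding quadratizable_with_def by auto
qed

section \<open>Degree comparison and the normal form p = L w\<close>

lemma quadratic_bounds:
  fixes z :: "complex poly"
  assumes "degree L \<le> 1" "degree G \<le> 2" "2 \<le> degree z"
  shows "degree (L * z + G) \<le> degree z + 1"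
    and "A \<noteq> 0 \<Longrightarrow> degree (smult A (z ^ 2) + L * z + G) = 2 * degree z"
proof -
  show lower: "degree (L * z + G) \<le> degree z + 1"
    using assms by (intro degree_add_le order_trans[OF degree_mult_le]) auto
  have "degree (smult A (z ^ 2)) = 2 * degree z" if "A \<noteq> 0"
    using that assms(3) by (subst degree_smult_eq, subst degree_power_eq) auto
  \<comment> \<open>As deg z >= 2, the degree 2 deg z exceeds deg z + 1, so the square term cannot
    be cancelled.\<close>
  with lower assms(3) show "degree (smult A (z ^ 2) + L * z + G) = 2 * degree z" if "A \<noteq> 0"
    using that degree_add_eq_left[of "L * z + G" "smult A (z ^ 2)"] by (simp add: add.assoc)
qed

text \<open>The degree of z' p is deg z - 1 + deg p, whereas a quadratic expression in z has degree
  exactly 2 deg z or at most deg z + 1. Both cases give deg p \<le> deg z + 1, which rules out z^2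
  in p.\<close>

lemma quadratization_degrees:
  fixes p z :: "complex poly"
  assumes p_degree: "5 \<le> degree p"
    and "quadratic_in z p" "quadratic_in z (pderiv z * p)"
  obtains L G where "p = L * z + G" "degree L = 1" "degree G \<le> 2" "degree p = degree z + 1"
proof -
  obtain A L G where p: "p = smult A (z ^ 2) + L * z + G" and L: "degree L \<le> 1" and G: "degree G \<le> 2"
    using assms(2) by (rule quadratic_inE)
  obtain D M H where zp: "pderiv z * p = smult D (z ^ 2) + M * z + H" and M: "degree M \<le> 1" and H: "degree H \<le> 2"
    using assms(3) by (rule quadratic_inE)
  have z_degree: "2 \<le> degree z"
  proof (rule ccontr)
    assume "\<not> 2 \<le> degree z"
    then have z: "degree z \<le> 1" by simp
    have "degree (z ^ 2) \<le> 2" "degree (L * z) \<le> 2"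
      using z L degree_mult_le[of z z] degree_mult_le[of L z] by (auto simp: power2_eq_square)
    then have "degree p \<le> 2"
      unfolding p using G by (intro degree_add_le order_trans[OF degree_smult_le])
    then show False using p_degree by simp
  qed
  then have "pderiv z \<noteq> 0" "p \<noteq> 0"
    using p_degree by (auto simp: pderiv_eq_0_iff)
  then have zp_degree: "degree (pderiv z * p) = degree z - 1 + degree p"
    by (simp add: degree_mult_eq degree_pderiv)
  have D0: "degree (pderiv z * p) = 2 * degree z" if "D \<noteq> 0"
    unfolding zp using quadratic_bounds(2)[OF M H z_degree that] .
  have D1: "degree (pderiv z * p) \<le> degree z + 1" if "D = 0"
    unfolding zp using quadratic_bounds(1)[OF M H z_degree] that by simp
  have le: "degree p \<le> degree z + 1"
    using D0 D1 zp_degree z_degree by (cases "D = 0") auto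
  have "A = 0"
  proof (rule ccontr)
    assume "A \<noteq> 0"
    then have "degree p = 2 * degree z"
      unfolding p by (rule quadratic_bounds(2)[OF L G z_degree])
    then show False using le z_degree p_degree by simp
  qed
  then have p': "p = L * z + G" using p by simp
  \<comment> \<open>For constant L, deg p = deg z >= 5, so z' p would have degree 2 deg z - 1,
    strictly between deg z + 1 and 2 deg z.\<close>
  have "degree L \<noteq> 0"
  proof
    assume L0: "degree L = 0"
    have "degree (L * z) = degree z"
    proof (cases "L = 0")
      case True
      then show ?thesis using p' G p_degree by simp
    next
      case False
      then show ?thesis using L0 z_degree by (subst degree_mult_eq) auto
    qed
    moreover from this have "degree p = degree z"
      using p' G p_degree le by (simp add: degree_add_eq_left)
    ultimately show False
      using D0 D1 zp_degree p_degree by (cases "D = 0") auto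
  qed
  with L have L1: "degree L = 1" by simp
  then have "degree (L * z) = degree z + 1"
    using z_degree by (subst degree_mult_eq) auto
  then have "degree p = degree z + 1"
    unfolding p' using G z_degree by (simp add: degree_add_eq_left)
  with p' L1 G that show thesis by blast
qed

lemma quadratization_normal_form:
  fixes p z :: "complex poly"
  assumes p_degree: "5 \<le> degree p"
    and "quadratic_in z p" "quadratic_in z (pderiv z * p)"
  obtains L w D M where "p = L * w" "degree L = 1" "degree p = degree w + 1"
    "L * pderiv w = smult D w + M" "degree M \<le> 1"
proof -
  obtain L G where p: "p = L * z + G" and L: "degree L = 1" and G: "degree G \<le> 2"
    and deg: "degree p = degree z + 1"
    using assms by (rule quadratization_degrees)
  obtain D M H where zp: "pderiv z * p = smult D (z ^ 2) + M * z + H" and M: "degree M \<le> 1" and H: "degree H \<le> 2"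
    using assms(3) by (rule quadratic_inE)
  define Q R where "Q = G div L" and "R = G mod L"
  have G_eq: "G = L * Q + R" by (simp add: Q_def R_def)
  have "L \<noteq> 0" using L by auto
  have R: "degree R = 0"
    using degree_mod_less[OF \<open>L \<noteq> 0\<close>, of G] L by (auto simp: R_def)
  have "degree (L * Q) \<le> 2"
    using degree_diff_le[of G 2 R] G R by (simp add: G_eq)
  then have Q: "degree Q \<le> 1"
    using L \<open>L \<noteq> 0\<close> by (cases "Q = 0") (auto simp: degree_mult_eq)
  define w where "w = z + Q"
  have w: "degree w = degree z"
    unfolding w_def using Q deg p_degree by (intro degree_add_eq_left) auto
  have p': "p = L * w + R" by (simp add: p G_eq w_def algebra_simps)
  \<comment> \<open>\<open>M'\<close> and \<open>H'\<close> collect the terms of w' p = z' p + Q' p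
    after substituting z = w - Q and p = L w + R.\<close>
  define M' where "M' = M - smult D (2 * Q) + pderiv Q * L"
  define H' where "H' = smult D (Q ^ 2) - M * Q + H + pderiv Q * R"
  have Q': "degree (pderiv Q) = 0" using Q by (simp add: degree_pderiv)
  have M': "degree M' \<le> 1"
    unfolding M'_def using M Q Q' L
    by (intro degree_add_le degree_diff_le order_trans[OF degree_mult_le] order_trans[OF degree_smult_le]) auto
  have H': "degree H' \<le> 2"
    unfolding H'_def power2_eq_square using M Q Q' R H
    by (intro degree_add_le degree_diff_le order_trans[OF degree_mult_le] order_trans[OF degree_smult_le]) auto
  have "pderiv w * p = pderiv z * p + pderiv Q * p"
    by (simp add: w_def pderiv_add algebra_simps)
  also have "\<dots> = smult D ((w - Q) ^ 2) + M * (w - Q) + H + pderiv Q * (L * w + R)"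
    using zp p' by (simp add: w_def)
  also have "\<dots> = smult D (w ^ 2) + M' * w + H'"
  proof -
    \<comment> \<open>Turning the scalar into a constant polynomial makes the expansion a pure ring
      identity.\<close>
    have "smult D q = [:D:] * q" for q by simp
    moreover have "d * (w - Q) ^ 2 + M * (w - Q) + H + e * (L * w + R)
        = d * w ^ 2 + (M - d * (2 * Q) + e * L) * w + (d * Q ^ 2 - M * Q + H + e * R)" for d e
      by (simp add: power2_eq_square algebra_simps)
    ultimately show ?thesis
      unfolding M'_def H'_def by (simp only:)
  qed
  finally have "(L * w + R) * pderiv w = smult D (w ^ 2) + M' * w + H'"
    by (simp add: p' mult.commute)
  \<comment> \<open>The left side is a multiple of w and the right side has degree below deg w, so
    both vanish.\<close>
  then have key: "w * (L * pderiv w - smult D w - M') = H' - R * pderiv w"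
    by (simp add: algebra_simps power2_eq_square)
  have w'_degree: "degree (pderiv w) = degree w - 1" by (simp add: degree_pderiv)
  have w_ge: "4 \<le> degree w" using w deg p_degree by simp
  have "degree (H' - R * pderiv w) \<le> degree w - 1"
    using H' R w'_degree w_ge by (intro degree_diff_le order_trans[OF degree_mult_le]) auto
  with w_ge have less: "degree (w * (L * pderiv w - smult D w - M')) < degree w"
    unfolding key by simp
  have zero: "L * pderiv w - smult D w - M' = 0"
  proof (rule ccontr)
    assume "L * pderiv w - smult D w - M' \<noteq> 0"
    then show False using less w_ge by (subst (asm) degree_mult_eq) auto
  qed
  with key have H'_eq: "H' = R * pderiv w" by simp
  \<comment> \<open>R is constant; if it were nonzero, \<open>H'\<close> would have degree deg w - 1
    >= 3, against its bound 2. This uses deg p >= 5.\<close>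
  have "R = 0"
  proof (rule ccontr)
    assume "R \<noteq> 0"
    moreover have "pderiv w \<noteq> 0" using w_ge by (auto simp: pderiv_eq_0_iff)
    ultimately have "degree H' = degree w - 1"
      unfolding H'_eq by (simp add: degree_mult_eq R w'_degree)
    then show False using H' w_ge by simp
  qed
  with p' have "p = L * w" by simp
  moreover from zero have "L * pderiv w = smult D w + M'" by (simp add: algebra_simps)
  ultimately show thesis
    using that L M' deg w by metis
qed

section \<open>Coefficients around the root of L\<close>

text \<open>Moving the root -C/B to 0 yields the Euler equation B x W' = D W + (affine), which is
  diagonal on monomials: (B k - D) W_k = 0 for k >= 2. At most one such k can have a nonzero
  coefficient, and it must be deg W.\<close>

lemma centred_form:
  fixes p w :: "complex poly"
  assumes p: "p = [:C, B:] * w" and B: "B \<noteq> 0"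
    and w: "degree w = Suc m" "1 \<le> m"
    and ode: "[:C, B:] * pderiv w = smult D w + M" and M: "degree M \<le> 1"
  shows "\<exists>\<alpha> \<beta>. pcompose p [:- (C / B), 1:]
      = monom (coeff p (m + 2)) (m + 2) + monom \<alpha> 2 + monom \<beta> 1"
proof -
  define r where "r = [:- (C / B), 1:]"
  define W where "W = pcompose w r"
  have centre: "pcompose [:C, B:] r = [:0, B:]"
    using B by (simp add: r_def pcompose_pCons)
  have W_degree: "degree W = Suc m" and W_lead: "coeff W (Suc m) = coeff w (Suc m)"
    using lead_coeff_comp[of r w] w by (auto simp: W_def r_def degree_pcompose)
  have "pcompose ([:C, B:] * pderiv w) r = pcompose (smult D w + M) r"
    using ode by simp
  then have "[:0, B:] * pcompose (pderiv w) r = smult D W + pcompose M r"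
    by (simp only: pcompose_mult pcompose_add pcompose_smult centre W_def)
  moreover have "pcompose (pderiv w) r = pderiv W"
    by (simp add: W_def pderiv_pcompose) (simp add: r_def pderiv_pCons)
  ultimately have "[:0, B:] * pderiv W = smult D W + pcompose M r"
    by simp
  then have "coeff ([:0, B:] * pderiv W) (Suc k) = coeff (smult D W + pcompose M r) (Suc k)" for k
    by simp
  moreover have "coeff (pcompose M r) (Suc k) = 0" if "1 \<le> k" for k
    using that M by (intro coeff_eq_0) (simp add: degree_pcompose r_def)
  ultimately have rec: "B * of_nat (Suc k) * coeff W (Suc k) = D * coeff W (Suc k)" if "1 \<le> k" for k
    using that by (simp add: coeff_pderiv mult.assoc)
  have "coeff W (Suc m) \<noteq> 0"
    using W_degree by (metis leading_coeff_0_iff degree_0 nat.distinct(1))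
  \<comment> \<open>Since m >= 1, the leading index is at least 2, so the recurrence applies there
    and fixes D.\<close>
  with rec[OF w(2)] have D: "D = B * of_nat (Suc m)" by simp
  have W0: "coeff W (Suc k) = 0" if "1 \<le> k" "k \<noteq> m" for k
    using rec[OF that(1)] that(2) B unfolding D by (simp add: of_nat_eq_iff del: of_nat_Suc)
  have "coeff p (m + 2) = B * coeff w (Suc m)"
    using w by (simp add: p coeff_eq_0)
  moreover have "pcompose p r = [:0, B:] * W"
    by (simp only: p pcompose_mult centre W_def)
  \<comment> \<open>Multiplication by B x shifts indices by one: positions 0, 1, m + 1 of W become
    1, 2, m + 2.\<close>
  ultimately have "coeff (pcompose p r) k = coeff (monom (coeff p (m + 2)) (m + 2)
      + monom (B * coeff W 1) 2 + monom (B * coeff W 0) 1) k" for k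
    using W0 W_lead w(2)
    by (cases k; cases "k - 1"; cases "k - 2 = m")
      (auto simp: numeral_2_eq_2)
  then show ?thesis
    unfolding r_def by (intro exI poly_eqI)
qed

section \<open>Identifying the shift and the explicit new variable\<close>

text \<open>The inverse translation expresses p in powers of x + s. As n - 1 >= 3, only (x + s)^n
  contributes to x^(n-1), so the coefficients of p determine s.\<close>

lemma shift_eq_coeff_quotient:
  fixes p :: "complex poly"
  assumes "pcompose p [:- s, 1:] = monom c n + monom \<alpha> 2 + monom \<beta> 1" and "4 \<le> n" "c \<noteq> 0"
  shows "p = smult c ([:s, 1:] ^ n) + smult \<alpha> ([:s, 1:] ^ 2) + smult \<beta> [:s, 1:]"
    and "coeff p (n - 1) = of_nat n * s * c"
proof -
  have monom: "pcompose (monom b k) q = smult b (q ^ k)" for b k and q :: "complex poly"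
    by (induction k) (auto simp: monom_0 monom_Suc pcompose_pCons)
  have "p = pcompose (pcompose p [:- s, 1:]) [:s, 1:]"
    by (simp add: pcompose_assoc[symmetric] pcompose_pCons)
  then show p: "p = smult c ([:s, 1:] ^ n) + smult \<alpha> ([:s, 1:] ^ 2) + smult \<beta> [:s, 1:]"
    unfolding assms(1) by (simp add: pcompose_add monom)
  have "coeff ([:s, 1:] ^ n) (n - 1) = of_nat n * s"
    using assms(2) binomial_symmetric[of 1 n] by (simp add: coeff_linear_poly_power)
  moreover have "coeff ([:s, 1:] ^ 2) (n - 1) = 0" "coeff [:s, 1:] (n - 1) = 0"
    using assms(2) by (intro coeff_eq_0; simp add: degree_power_eq)+
  ultimately show "coeff p (n - 1) = of_nat n * s * c"
    by (subst p, unfold coeff_add coeff_smult) simp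
qed

text \<open>With z = y^(n-1) and y' = 1, p = c y z + \<alpha> y^2 + \<beta> y and z' p = (n-1) (c
  z^2 + \<alpha> y z + \<beta> z).\<close>

lemma quadratizes_shifted_power:
  fixes y :: "complex poly"
  assumes y: "y = [:s, 1:]" and p: "p = smult c (y ^ n) + smult \<alpha> (y ^ 2) + smult \<beta> y" and n: "2 \<le> n"
  shows "quadratizes [y ^ (n - 1)] p"
proof -
  obtain k where k: "n = Suc (Suc k)" using n by (metis add_2_eq_Suc le_Suc_ex)
  have deg: "degree y = 1" by (simp add: y)
  have "quadratic_in (y ^ Suc k) p"
    by (rule quadratic_inI[of _ 0 _ "smult c y" "smult \<alpha> (y ^ 2) + smult \<beta> y"])
      (auto simp: p k deg degree_power_eq intro!: degree_add_le order_trans[OF degree_smult_le] order_trans[OF degree_power_le])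
  moreover have "pderiv (y ^ Suc k) = smult (of_nat (Suc k)) (y ^ k)"
    by (simp only: pderiv_power_Suc) (simp add: y pderiv_pCons)
  then have "pderiv (y ^ Suc k) * p = smult (of_nat (Suc k)) (smult c ((y ^ Suc k) ^ 2)
      + (smult \<alpha> y + [:\<beta>:]) * y ^ Suc k + 0)"
    by (simp add: p k power2_eq_square smult_add_right algebra_simps)
  then have "quadratic_in (y ^ Suc k) (pderiv (y ^ Suc k) * p)"
    by (simp only:) (intro quadratic_in_smult quadratic_inI[OF refl],
        auto simp: deg intro!: degree_add_le order_trans[OF degree_smult_le])
  ultimately show ?thesis by (simp add: quadratizes_single_iff k)
qed

theorem theorem3p1:
  fixes n :: nat and a :: "nat \<Rightarrow> complex" and p :: "complex poly"
  assumes "n \<ge> 5"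
    and "p = (\<Sum>i\<le>n. monom (a i) i)"
    and "a n \<noteq> 0"
  shows "(quadratizable_with 1 p \<longleftrightarrow>
           (\<exists>\<alpha> \<beta> :: complex.
              pcompose p [:- (a (n - 1) / (of_nat n * a n)), 1:]
                = monom (a n) n + monom \<alpha> 2 + monom \<beta> 1))
       \<and> (quadratizable_with 1 p \<longrightarrow>
           quadratizes [[:a (n - 1) / (of_nat n * a n), 1:] ^ (n - 1)] p)"
proof -
  let ?s = "a (n - 1) / (of_nat n * a n)"
  let ?form = "\<exists>\<alpha> \<beta>. pcompose p [:- ?s, 1:] = monom (a n) n + monom \<alpha> 2 + monom \<beta> 1"
  have coeff_p: "coeff p k = (if k \<le> n then a k else 0)" for k
    by (simp add: assms(2) coeff_sum)
  have deg_p: "degree p = n"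
    using assms(3) coeff_p by (intro order_antisym degree_le le_degree) auto
  have form: ?form if quad: "quadratizable_with 1 p"
  proof -
    obtain z where "quadratic_in z p" "quadratic_in z (pderiv z * p)"
      using quad unfolding quadratizable_with_1_iff quadratizes_single_iff by blast
    then obtain L w D M where p: "p = L * w" and L: "degree L = 1" and deg: "degree p = degree w + 1"
      and ode: "L * pderiv w = smult D w + M" and M: "degree M \<le> 1"
      using quadratization_normal_form assms(1) deg_p by metis
    define C B where "C = coeff L 0" and "B = coeff L 1"
    have L_eq: "L = [:C, B:]" using degree_le_1_eq[of L] L unfolding C_def B_def by linarith
    with L have B: "B \<noteq> 0" by auto
    obtain m where m: "n = m + 2" using assms(1) that[of "n - 2"] by simp
    have "\<exists>\<alpha> \<beta>. pcompose p [:- (C / B), 1:] = monom (coeff p (m + 2)) (m + 2) + monom \<alpha> 2 + monom \<beta> 1"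
      using p B ode M deg deg_p m assms(1) unfolding L_eq by (intro centred_form) auto
    then obtain \<alpha> \<beta> where eq: "pcompose p [:- (C / B), 1:] = monom (a n) n + monom \<alpha> 2 + monom \<beta> 1"
      using m coeff_p by auto
    \<comment> \<open>The root of L came from an arbitrary quadratization; the coefficient of
      x^(n-1) identifies it with the prescribed shift.\<close>
    have "a (n - 1) = of_nat n * (C / B) * a n"
      using shift_eq_coeff_quotient(2)[OF eq] assms coeff_p by simp
    then have "?s = C / B" using assms by simp
    with eq show ?form by metis
  qed
  have quad: "quadratizes [[:?s, 1:] ^ (n - 1)] p" if shifted: ?form
  proof -
    obtain \<alpha> \<beta> where eq: "pcompose p [:- ?s, 1:] = monom (a n) n + monom \<alpha> 2 + monom \<beta> 1"
      using shifted by blast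
    have "4 \<le> n" using assms(1) by simp
    from quadratizes_shifted_power[OF refl shift_eq_coeff_quotient(1)[OF eq this assms(3)]] \<open>4 \<le> n\<close>
    show ?thesis by simp
  qed
  \<comment> \<open>The explicit witness in \<open>quad\<close> gives the converse and, composed
    with \<open>form\<close>, the claim about the new variable.\<close>
  show ?thesis using form quad quadratizable_with_1_iff by blast
qed

end
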